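(* Let $m,k\ge 1$ be integers, let $\mathcal{F}_1\subset\{-1,+1\}^m$ be a fractional factorial design of the factors $x_1,\ldots,x_m$, let $e_1,\ldots,e_k\in\{-1,1\}$ and let $\mathbf{b}_1,\ldots,\mathbf{b}_k\in\{0,1\}^m$. Let $\mathcal{F}_2\subset\{-1,+1\}^{m+k}$ be the design of the factors $x_1,\ldots,x_m,y_1,\ldots,y_k$ obtained from $\mathcal{F}_1$ by adding the factors $y_1,\ldots,y_k$ with levels determined by $y_j=e_j\mathbf{x}^{\mathbf{b}_j}$, $j=1,\ldots,k$; that is, $$\mathcal{F}_2=\{(x_1,\ldots,x_m,y_1,\ldots,y_k)\ |\ (x_1,\ldots,x_m)\in\mathcal{F}_1,\ y_j=e_j\mathbf{x}^{\mathbf{b}_j}\text{ for } j=1,\ldots,k\}.$$ Let $f_1$ and $f_2$ be the indicator functions of $\mathcal{F}_1$ and $\mathcal{F}_2$, respectively. Then $$f_2(x_1,\ldots,x_m,y_1,\ldots,y_k)=\frac{1}{2^k}\left(1+e_1y_1\mathbf{x}^{\mathbf{b}_1}\right)\cdots\left(1+e_ky_k\mathbf{x}^{\mathbf{b}_k}\right)f_1(x_1,\ldots,x_m),$$ where the equality is understood under the constraints $x_i^2=1$ $(i=1,\ldots,m)$ and $y_j^2=1$ $(j=1,\ldots,k)$, i.e. as functions on $\{-1,+1\}^{m+k}$.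
   Context: $K$ is a field which is a finite extension of $\mathbb{Q}$ (for two-level factors one may take $K=\mathbb{Q}$). For $\mathbf{a}=(a_1,\ldots,a_m)\in\{0,1\}^m$, write $\mathbf{x}^{\mathbf{a}}=x_1^{a_1}\cdots x_m^{a_m}$. The full factorial design of $r$ two-level factors is $\mathcal{D}=\{-1,+1\}^r$, and a fractional factorial design of $r$ two-level factors is a subset $\mathcal{F}\subset\mathcal{D}$. The indicator function of $\mathcal{F}\subset\mathcal{D}=\{-1,+1\}^r$ is a polynomial $f$ in $r$ indeterminates over $K$ such that $f(\mathbf{z})=1$ for $\mathbf{z}\in\mathcal{F}$ and $f(\mathbf{z})=0$ for $\mathbf{z}\in\mathcal{D}\setminus\mathcal{F}$. It has a unique square-free representation under the constraint that the square of each indeterminate equals $1$; indicator functions are identified when they agree under this constraint. *)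

theory Defs
  imports Complex_Main "HOL-Library.Poly_Mapping" "HOL-Library.FuncSet"
begin

text \<open>The ground field is a type of class \<open>field_char_0\<close>, i.e. a field containing the rationals
  via \<^const>\<open>of_rat\<close>; it is a finite extension of the rationals if it is finite-dimensional over them.\<close>

definition finite_extension_of_rat :: "'k::field_char_0 itself \<Rightarrow> bool" where
  "finite_extension_of_rat _ \<longleftrightarrow>
     (\<exists>B :: 'k set. finite_dimensional_vector_space (\<lambda>(q::rat) (x::'k). of_rat q * x) B)"


subsection \<open>Polynomials\<close>

text \<open>Polynomials in indeterminates indexed by \<^typ>\<open>nat\<close>: finitely supported maps from exponent
  vectors to coefficients. A polynomial in \<open>r\<close> indeterminates is one that involves only the
  indeterminates with index below \<open>r\<close>.\<close>

type_synonym 'k mpoly = "(nat \<Rightarrow>\<^sub>0 nat) \<Rightarrow>\<^sub>0 'k"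

definition Const :: "'k::zero \<Rightarrow> 'k mpoly" where
  "Const c = Poly_Mapping.single 0 c"

definition Var :: "nat \<Rightarrow> 'k::zero_neq_one mpoly" where
  "Var i = Poly_Mapping.single (Poly_Mapping.single i 1) 1"

definition indets :: "'k::zero mpoly \<Rightarrow> nat set" where
  "indets p = (\<Union>t\<in>Poly_Mapping.keys p. Poly_Mapping.keys t)"

definition polys :: "nat \<Rightarrow> 'k::zero mpoly set" where
  "polys r = {p. indets p \<subseteq> {..<r}}"

definition eval_poly :: "'k::comm_semiring_1 mpoly \<Rightarrow> (nat \<Rightarrow> 'k) \<Rightarrow> 'k" where
  "eval_poly p z = (\<Sum>t\<in>Poly_Mapping.keys p.
     Poly_Mapping.lookup p t * (\<Prod>i\<in>Poly_Mapping.keys t. z i ^ Poly_Mapping.lookup t i))"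

text \<open>The product \<open>x\<^sub>0\<^bsup>a 0\<^esup> \<cdots> x\<^sub>m\<^sub>-\<^sub>1\<^bsup>a (m-1)\<^esup>\<close>, used both for levels
  (\<open>x\<close> a design point) and for polynomials (\<open>x = Var\<close>).\<close>

definition monomial :: "nat \<Rightarrow> (nat \<Rightarrow> 'a::comm_monoid_mult) \<Rightarrow> (nat \<Rightarrow> nat) \<Rightarrow> 'a" where
  "monomial m x a = (\<Prod>i<m. x i ^ a i)"


subsection \<open>Two-level designs and indicator functions\<close>

definition full_design :: "nat \<Rightarrow> (nat \<Rightarrow> 'k::ring_1) set" where
  "full_design r = {..<r} \<rightarrow>\<^sub>E {-1, 1}"

definition is_indicator_function ::
    "nat \<Rightarrow> (nat \<Rightarrow> 'k::comm_ring_1) set \<Rightarrow> 'k mpoly \<Rightarrow> bool" where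
  "is_indicator_function r F f \<longleftrightarrow> f \<in> polys r \<and>
     (\<forall>z\<in>F. eval_poly f z = 1) \<and> (\<forall>z\<in>full_design r - F. eval_poly f z = 0)"

text \<open>Equality of polynomials under the constraint that the square of each indeterminate is 1,
  i.e. as functions on the full factorial design.\<close>

definition eq_under_constraints :: "nat \<Rightarrow> 'k::comm_ring_1 mpoly \<Rightarrow> 'k mpoly \<Rightarrow> bool" where
  "eq_under_constraints r p q \<longleftrightarrow> (\<forall>z\<in>full_design r. eval_poly p z = eval_poly q z)"

text \<open>The factor \<open>y\<^sub>j\<close> added to a design of \<open>m\<close> factors is the one with index \<open>m + j\<close>.\<close>

definition join_point :: "nat \<Rightarrow> nat \<Rightarrow> (nat \<Rightarrow> 'a) \<Rightarrow> (nat \<Rightarrow> 'a) \<Rightarrow> nat \<Rightarrow> 'a" where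
  "join_point m k x y = (\<lambda>i\<in>{..<m + k}. if i < m then x i else y (i - m))"

definition add_factors ::
    "nat \<Rightarrow> nat \<Rightarrow> (nat \<Rightarrow> 'k::comm_ring_1) \<Rightarrow> (nat \<Rightarrow> nat \<Rightarrow> nat) \<Rightarrow> (nat \<Rightarrow> 'k) set \<Rightarrow> (nat \<Rightarrow> 'k) set"
where
  "add_factors m k e b F =
     {join_point m k x y | x y. x \<in> F \<and> (\<forall>j<k. y j = e j * monomial m x (b j))}"

end

theory Submission
  imports Defs
begin

text \<open>Evaluation is a ring homomorphism, so at a design point \<open>z\<close> the factor belonging to \<open>y\<^sub>j\<close>
  becomes \<open>1 + y\<^sub>j \<cdot> e\<^sub>j x\<^bsup>b\<^sub>j\<^esup>\<close> with \<open>y\<^sub>j\<close> and \<open>e\<^sub>j x\<^bsup>b\<^sub>j\<^esup>\<close> both \<open>\<plusminus> 1\<close>: it is \<open>2\<close> if they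
  agree and \<open>0\<close> otherwise. Hence the normalised product is the indicator of the added relations,
  and multiplying by the indicator of the original design gives that of the extended one.\<close>

definition eval_mono :: "(nat \<Rightarrow>\<^sub>0 nat) \<Rightarrow> (nat \<Rightarrow> 'k::comm_semiring_1) \<Rightarrow> 'k" where
  "eval_mono t z = (\<Prod>i\<in>Poly_Mapping.keys t. z i ^ Poly_Mapping.lookup t i)"

text \<open>Indices outside the support contribute \<open>z i ^ 0 = 1\<close>, so monomials with
  different supports can be compared over one common index set.\<close>

lemma eval_mono_superset:
  assumes "finite A" "Poly_Mapping.keys t \<subseteq> A"
  shows "eval_mono t z = (\<Prod>i\<in>A. z i ^ Poly_Mapping.lookup t i)"
  unfolding eval_mono_def
  by (rule prod.mono_neutral_left) (use assms in \<open>auto simp: in_keys_iff\<close>)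

lemma eval_mono_add: "eval_mono (s + t) z = eval_mono s z * eval_mono t z"
proof -
  let ?A = "Poly_Mapping.keys s \<union> Poly_Mapping.keys t"
  show ?thesis
    using Poly_Mapping.keys_add[of s t]
    by (simp add: eval_mono_superset[of ?A] lookup_add power_add prod.distrib)
qed

lemma eval_poly_superset:
  assumes "finite A" "Poly_Mapping.keys p \<subseteq> A"
  shows "eval_poly p z = (\<Sum>t\<in>A. Poly_Mapping.lookup p t * eval_mono t z)"
  unfolding eval_poly_def eval_mono_def
  by (rule sum.mono_neutral_left) (use assms in \<open>auto simp: in_keys_iff\<close>)

lemma eval_poly_add: "eval_poly (p + q) z = eval_poly p z + eval_poly q z"
proof -
  let ?A = "Poly_Mapping.keys p \<union> Poly_Mapping.keys q"
  show ?thesis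
    using Poly_Mapping.keys_add[of p q]
    by (simp add: eval_poly_superset[of ?A] lookup_add distrib_right sum.distrib)
qed

lemma eval_poly_single: "eval_poly (Poly_Mapping.single t c) z = c * eval_mono t z"
  by (subst eval_poly_superset[of "{t}"]) auto

lemma eval_poly_Const: "eval_poly (Const c) z = c"
  by (simp add: Const_def eval_poly_single eval_mono_def)

lemma eval_poly_one: "eval_poly 1 z = 1"
  using eval_poly_Const[of 1 z] by (simp add: Const_def)

lemma eval_poly_Var: "eval_poly (Var i) z = z i"
  by (simp add: Var_def eval_poly_single eval_mono_def)

text \<open>Tailored to statements additive in \<open>p\<close>: these reduce to single terms, which
  is how multiplicativity of evaluation is obtained.\<close>

lemma poly_mapping_single_add_induct [case_names single add]:
  fixes p :: "'a \<Rightarrow>\<^sub>0 'b::monoid_add"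
  assumes single: "\<And>t c. P (Poly_Mapping.single t c)"
    and add: "\<And>p q. P p \<Longrightarrow> P q \<Longrightarrow> P (p + q)"
  shows "P p"
proof (induction p rule: update_induct)
  case const
  show ?case
    using single[of _ 0] by simp
next
  case (update f a b)
  \<comment> \<open>Since \<open>a\<close> lies outside the support of \<open>f\<close>, updating
    there overwrites nothing and amounts to adding a term.\<close>
  have "Poly_Mapping.update a b f = Poly_Mapping.single a b + f"
    using update(1)
    by (intro poly_mapping_eqI) (auto simp: lookup_update lookup_add lookup_single in_keys_iff)
  then show ?case
    using add[OF single update(3)] by simp
qed

text \<open>Both sides are additive in \<open>p\<close> and in \<open>q\<close>, so two nested
  inductions leave a product of two terms, where exponent vectors add.\<close>

lemma eval_poly_mult: "eval_poly (p * q) z = eval_poly p z * eval_poly q z"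
proof (induction p rule: poly_mapping_single_add_induct)
  case (single s c)
  show ?case
  proof (induction q rule: poly_mapping_single_add_induct)
    case (single t d)
    show ?case
      by (simp add: mult_single eval_poly_single eval_mono_add mult_ac)
  qed (simp add: eval_poly_add distrib_left)
qed (simp add: eval_poly_add distrib_right)

lemma eval_poly_power: "eval_poly (p ^ n) z = eval_poly p z ^ n"
  by (induction n) (simp_all add: eval_poly_one eval_poly_mult)

lemma eval_poly_prod: "eval_poly (\<Prod>i\<in>A. p i) z = (\<Prod>i\<in>A. eval_poly (p i) z)"
  by (induction A rule: infinite_finite_induct) (simp_all add: eval_poly_one eval_poly_mult)

lemma eval_poly_monomial: "eval_poly (monomial m Var a) z = monomial m z a"
  by (simp add: monomial_def eval_poly_prod eval_poly_power eval_poly_Var)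

lemmas eval_poly_simps = eval_poly_add eval_poly_mult eval_poly_one eval_poly_Const
  eval_poly_Var eval_poly_prod eval_poly_monomial

text \<open>Lets a polynomial in the first \<open>m\<close> indeterminates be evaluated at points
  carrying further coordinates.\<close>

lemma eval_poly_cong:
  assumes "p \<in> polys m" "\<And>i. i < m \<Longrightarrow> z i = w i"
  shows "eval_poly p z = eval_poly p w"
proof -
  have "z i = w i" if "t \<in> Poly_Mapping.keys p" "i \<in> Poly_Mapping.keys t" for t i
    using that assms by (auto simp: polys_def indets_def)
  then show ?thesis
    by (simp add: eval_poly_def)
qed

lemma monomial_cong: "(\<And>i. i < m \<Longrightarrow> x i = y i) \<Longrightarrow> monomial m x a = monomial m y a"
  by (simp add: monomial_def)

lemma monomial_in_signs:
  fixes x :: "nat \<Rightarrow> 'a::comm_ring_1"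
  assumes "\<And>i. i < m \<Longrightarrow> x i \<in> {-1, 1}"
  shows "monomial m x a \<in> {-1, 1}"
  using assms
proof (induction m)
  case (Suc m)
  have "x m ^ a m \<in> {-1, 1}"
    using Suc.prems[of m] by (cases "even (a m)") auto
  moreover have "monomial m x a \<in> {-1, 1}"
    using Suc by simp
  ultimately show ?case
    by (auto simp: monomial_def)
qed (simp add: monomial_def)

lemma eval_indicator_function:
  assumes "is_indicator_function r F f" "z \<in> full_design r"
  shows "eval_poly f z = (if z \<in> F then 1 else 0)"
  using assms by (auto simp: is_indicator_function_def)

lemma restrict_join_point:
  assumes "x \<in> extensional {..<m}"
  shows "restrict (join_point m k x y) {..<m} = x"
  using assms by (auto simp: join_point_def fun_eq_iff extensional_def)

text \<open>The coordinates of \<open>z\<close> determine both the original point and the added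
  levels, which removes the existential quantifiers. Extensionality matters because designs consist
  of functions that are \<open>undefined\<close> outside their index range.\<close>

lemma mem_add_factors_iff:
  assumes z: "z \<in> extensional {..<m + k}" and F: "F \<subseteq> extensional {..<m}"
  shows "z \<in> add_factors m k e b F \<longleftrightarrow>
    restrict z {..<m} \<in> F \<and> (\<forall>j<k. z (m + j) = e j * monomial m z (b j))"
proof
  assume "z \<in> add_factors m k e b F"
  then obtain x y where xy: "z = join_point m k x y" "x \<in> F"
      "\<forall>j<k. y j = e j * monomial m x (b j)"
    by (auto simp: add_factors_def)
  moreover have "monomial m z a = monomial m x a" for a
    by (rule monomial_cong) (simp add: xy(1) join_point_def)
  moreover have "z (m + j) = y j" if "j < k" for j
    using that by (simp add: xy(1) join_point_def)
  ultimately show "restrict z {..<m} \<in> F \<and> (\<forall>j<k. z (m + j) = e j * monomial m z (b j))"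
    using F by (auto simp: restrict_join_point)
next
  assume *: "restrict z {..<m} \<in> F \<and> (\<forall>j<k. z (m + j) = e j * monomial m z (b j))"
  \<comment> \<open>The witnesses are read off from \<open>z\<close>: its first \<open>m\<close>
    coordinates, and the remaining ones shifted down by \<open>m\<close>.\<close>
  have "z = join_point m k (restrict z {..<m}) (\<lambda>j. z (m + j))"
    using z by (auto simp: join_point_def fun_eq_iff extensional_def)
  moreover have "monomial m (restrict z {..<m}) a = monomial m z a" for a
    by (rule monomial_cong) simp
  ultimately show "z \<in> add_factors m k e b F"
    unfolding add_factors_def using * by (auto intro!: exI)
qed

text \<open>Distinct signs multiply to -1, so a single disagreement makes the whole product
  vanish.\<close>

lemma prod_one_plus_signs:
  fixes s t :: "nat \<Rightarrow> 'a::comm_ring_1"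
  assumes "\<And>j. j < k \<Longrightarrow> s j \<in> {-1, 1}" "\<And>j. j < k \<Longrightarrow> t j \<in> {-1, 1}"
  shows "(\<Prod>j<k. 1 + s j * t j) = (if \<forall>j<k. s j = t j then 2 ^ k else 0)"
proof (cases "\<forall>j<k. s j = t j")
  case True
  have "1 + s j * t j = 2" if "j < k" for j
    using True assms(1)[OF that] that by auto
  then show ?thesis
    using True by simp
next
  case False
  then obtain j where j: "j < k" "s j \<noteq> t j"
    by blast
  then have "1 + s j * t j = 0"
    using assms[OF j(1)] by auto
  then have "(\<Prod>j<k. 1 + s j * t j) = 0"
    using j by (intro prod_zero) auto
  then show ?thesis
    using False by auto
qed

theorem mainTheorem1:
  fixes m k :: nat
    and F1 F2 :: "(nat \<Rightarrow> 'k::field_char_0) set"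
    and e :: "nat \<Rightarrow> 'k"
    and b :: "nat \<Rightarrow> nat \<Rightarrow> nat"
    and f1 f2 :: "'k mpoly"
  assumes "finite_extension_of_rat TYPE('k)"
    and "m \<ge> 1" and "k \<ge> 1"
    and "F1 \<subseteq> full_design m"
    and "\<And>j. j < k \<Longrightarrow> e j \<in> {-1, 1}"
    and "\<And>j i. j < k \<Longrightarrow> i < m \<Longrightarrow> b j i \<in> {0, 1}"
    and "F2 = add_factors m k e b F1"
    and "is_indicator_function m F1 f1"
    and "is_indicator_function (m + k) F2 f2"
  shows "eq_under_constraints (m + k) f2
           (Const (1 / 2 ^ k) *
            (\<Prod>j<k. 1 + Const (e j) * Var (m + j) * monomial m Var (b j)) * f1)"
  unfolding eq_under_constraints_def
proof
  fix z :: "nat \<Rightarrow> 'k"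
  assume z: "z \<in> full_design (m + k)"
  let ?x = "restrict z {..<m}"
  let ?y = "\<lambda>j. e j * monomial m z (b j)"
  have z_sign: "z i \<in> {-1, 1}" if "i < m + k" for i
    using z that by (auto simp: full_design_def PiE_def Pi_def)
  have mon_sign: "monomial m z a \<in> {-1, 1}" for a
    by (rule monomial_in_signs) (use z_sign in simp)
  have y_sign: "?y j \<in> {-1, 1}" if "j < k" for j
    using assms(5)[OF that] mon_sign[of "b j"] by auto
  have x: "?x \<in> full_design m"
    using z_sign by (auto simp: full_design_def PiE_def Pi_def)
  have "f1 \<in> polys m"
    using assms(8) by (simp add: is_indicator_function_def)
  \<comment> \<open>The indicator property of \<open>f1\<close> concerns
    \<open>full_design m\<close>, so \<open>z\<close> is first truncated to its original
    factors.\<close>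
  then have "eval_poly f1 z = eval_poly f1 ?x"
    by (rule eval_poly_cong) simp
  then have f1: "eval_poly f1 z = (if ?x \<in> F1 then 1 else 0)"
    using eval_indicator_function[OF assms(8) x] by simp
  have f2: "eval_poly f2 z = (if ?x \<in> F1 \<and> (\<forall>j<k. z (m + j) = ?y j) then 1 else 0)"
  proof -
    have "z \<in> extensional {..<m + k}" "F1 \<subseteq> extensional {..<m}"
      using z assms(4) by (auto simp: full_design_def PiE_def)
    then show ?thesis
      using eval_indicator_function[OF assms(9) z] by (simp add: assms(7) mem_add_factors_iff)
  qed
  \<comment> \<open>Regrouping pairs each level \<open>z (m + j)\<close> with its prescribed value
    \<open>?y j\<close>, both of which are signs.\<close>
  have "(\<Prod>j<k. 1 + e j * z (m + j) * monomial m z (b j)) = (\<Prod>j<k. 1 + z (m + j) * ?y j)"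
    by (simp add: mult_ac)
  also have "\<dots> = (if \<forall>j<k. z (m + j) = ?y j then 2 ^ k else 0)"
    using z_sign y_sign by (intro prod_one_plus_signs) auto
  finally show "eval_poly f2 z = eval_poly (Const (1 / 2 ^ k) *
      (\<Prod>j<k. 1 + Const (e j) * Var (m + j) * monomial m Var (b j)) * f1) z"
    \<comment> \<open>The constant \<open>1 / 2 ^ k\<close> cancels \<open>2 ^ k\<close>, which is
      nonzero in characteristic 0; both sides become the same case distinction.\<close>
    by (simp add: eval_poly_simps f1 f2)
qed

end
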